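(* Let $p>3$ be a prime. For any $p$-adic integer $a$, we have $$\sum_{k=0}^{p-1}\binom{-a}{k}\binom{a-1}{k}H_k\equiv(-1)^{\langle a\rangle_p-1}\,2\sum_{0<k<\langle a\rangle_p}\frac1{a-k}\pmod{p^2},$$ $$\sum_{k=0}^{p-1}\binom{-a}{k}\binom{a-1}{k}H_k\equiv(-1)^{\langle a-1\rangle_p}\Bigl(2H_{\langle a-1\rangle_p}+(a-\langle a\rangle_p)B_{p-2}(a)\Bigr)\pmod{p^2},$$ and $$\sum_{k=0}^{p-1}\binom{-a}{k}\binom{a-1}{k}H_k\equiv(-1)^{\langle a\rangle_p}\,2\bigl(B_{p-1}(a)-B_{p-1}\bigr)\pmod{p}.$$
   Context: For $n\in\mathbb N=\{0,1,2,\ldots\}$, $H_n=\sum_{0<k\le n}\frac1k$ is the harmonic number (so $H_0=0$). For a prime $p$ and a $p$-adic integer $a$, $\langle a\rangle_p$ denotes the unique integer $r\in\{0,1,\ldots,p-1\}$ with $a\equiv r\pmod p$. $B_0,B_1,B_2,\ldots$ are the Bernoulli numbers (with $B_1=-\frac12$), and $B_n(x)=\sum_{k=0}^n\binom nk B_kx^{n-k}$ is the Bernoulli polynomial of degree $n$. $\binom{x}{k}=\frac{x(x-1)\cdots(x-k+1)}{k!}$ is the generalized binomial coefficient. Congruences modulo $p^j$ are congruences in the ring $\mathbb Z_p$ of $p$-adic integers. Empty sums are $0$. *)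

theory Defs
  imports
    "HOL-Computational_Algebra.Polynomial_Factorial"
    "Berlekamp_Zassenhaus.Finite_Field"
begin

section \<open>The ring of \<open>p\<close>-adic integers\<close>

text \<open>
  The prime \<open>p\<close> is the cardinality of an index type \<open>'p\<close> of class \<^class>\<open>prime_card\<close>, and
  the ring of \<open>p\<close>-adic integers is the inverse limit of the rings \<open>\<int>/p\<^sup>n\<int>\<close>: a \<open>p\<close>-adic integer
  is a sequence of representatives \<open>f n \<in> {0..<p\<^sup>n}\<close> with \<open>f (n+1) \<equiv> f n (mod p\<^sup>n)\<close>. Both
  conditions are expressed by the single equation below.
\<close>

typedef (overloaded) ('p::prime_card) padic_int =
  "{f :: nat \<Rightarrow> int. \<forall>n. f (Suc n) mod int CARD('p) ^ n = f n}"
  by (rule exI[of _ "\<lambda>_. 0"]) simp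

setup_lifting type_definition_padic_int

lemma coherent_mod:
  fixes f :: "nat \<Rightarrow> int"
  assumes "\<forall>n. f (Suc n) mod q ^ n = f n"
  shows "f n mod q ^ n = f n"
  using assms by (metis mod_mod_trivial)

lemma coherent_lift_mod:
  fixes f :: "nat \<Rightarrow> int"
  assumes f: "\<forall>n. f (Suc n) mod q ^ n = f n"
  shows "f (n + m) mod q ^ n = f n"
proof (induction m)
  case 0
  show ?case using coherent_mod[OF f] by simp
next
  case (Suc m)
  have "f (n + Suc m) mod q ^ n = f (Suc (n + m)) mod q ^ (n + m) mod q ^ n"
    by (simp add: mod_mod_cancel le_imp_power_dvd)
  also have "\<dots> = f n" using f Suc by simp
  finally show ?case .
qed

instantiation padic_int :: (prime_card) comm_ring_1
begin

lift_definition zero_padic_int :: "'a padic_int" is "\<lambda>_. 0" by simp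

lift_definition one_padic_int :: "'a padic_int" is "\<lambda>n. 1 mod int CARD('a) ^ n"
  by (simp add: mod_mod_cancel)

lift_definition plus_padic_int :: "'a padic_int \<Rightarrow> 'a padic_int \<Rightarrow> 'a padic_int"
  is "\<lambda>f g n. (f n + g n) mod int CARD('a) ^ n"
proof -
  fix f g :: "nat \<Rightarrow> int" and n
  assume "\<And>n. f (Suc n) mod int CARD('a) ^ n = f n" "\<And>n. g (Suc n) mod int CARD('a) ^ n = g n"
  then show "(f (Suc n) + g (Suc n)) mod int CARD('a) ^ Suc n mod int CARD('a) ^ n
      = (f n + g n) mod int CARD('a) ^ n"
    by (subst mod_mod_cancel, simp) (metis mod_add_eq)
qed

lift_definition uminus_padic_int :: "'a padic_int \<Rightarrow> 'a padic_int"
  is "\<lambda>f n. (- f n) mod int CARD('a) ^ n"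
proof -
  fix f :: "nat \<Rightarrow> int" and n
  assume "\<And>n. f (Suc n) mod int CARD('a) ^ n = f n"
  then show "(- f (Suc n)) mod int CARD('a) ^ Suc n mod int CARD('a) ^ n
      = (- f n) mod int CARD('a) ^ n"
    by (subst mod_mod_cancel, simp) (metis mod_minus_eq)
qed

lift_definition minus_padic_int :: "'a padic_int \<Rightarrow> 'a padic_int \<Rightarrow> 'a padic_int"
  is "\<lambda>f g n. (f n - g n) mod int CARD('a) ^ n"
proof -
  fix f g :: "nat \<Rightarrow> int" and n
  assume "\<And>n. f (Suc n) mod int CARD('a) ^ n = f n" "\<And>n. g (Suc n) mod int CARD('a) ^ n = g n"
  then show "(f (Suc n) - g (Suc n)) mod int CARD('a) ^ Suc n mod int CARD('a) ^ n
      = (f n - g n) mod int CARD('a) ^ n"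
    by (subst mod_mod_cancel, simp) (metis mod_diff_eq)
qed

lift_definition times_padic_int :: "'a padic_int \<Rightarrow> 'a padic_int \<Rightarrow> 'a padic_int"
  is "\<lambda>f g n. (f n * g n) mod int CARD('a) ^ n"
proof -
  fix f g :: "nat \<Rightarrow> int" and n
  assume "\<And>n. f (Suc n) mod int CARD('a) ^ n = f n" "\<And>n. g (Suc n) mod int CARD('a) ^ n = g n"
  then show "(f (Suc n) * g (Suc n)) mod int CARD('a) ^ Suc n mod int CARD('a) ^ n
      = (f n * g n) mod int CARD('a) ^ n"
    by (subst mod_mod_cancel, simp) (metis mod_mult_eq)
qed

instance
proof
  fix a b c :: "'a padic_int"
  show "a * b * c = a * (b * c)"
    by transfer (simp add: mod_simps mult.assoc)
  show "a * b = b * a"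
    by transfer (simp add: mult.commute)
  show "1 * a = a"
    by transfer (simp add: mod_simps coherent_mod)
  show "a + b + c = a + (b + c)"
    by transfer (simp add: mod_simps add.assoc)
  show "a + b = b + a"
    by transfer (simp add: add.commute)
  show "0 + a = a"
    by transfer (simp add: coherent_mod)
  show "- a + a = 0"
    by transfer (simp add: mod_simps)
  show "a - b = a + - b"
    by transfer (simp add: mod_simps)
  show "(a + b) * c = a * c + b * c"
    by transfer (simp add: mod_simps distrib_right)
  have "int CARD('a) > 1"
    using prime_gt_1_int[OF prime_card_int[where 'a = 'a]] .
  then show "(0 :: 'a padic_int) \<noteq> 1"
    by transfer (auto simp: fun_eq_iff intro!: exI[of _ 1])
qed

end

lemma of_nat_padic_int_rep:
  "Rep_padic_int (of_nat m :: 'p::prime_card padic_int) n = int m mod int CARD('p) ^ n"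
proof (induction m)
  case 0
  show ?case by (simp add: zero_padic_int.rep_eq)
next
  case (Suc m)
  then show ?case
    by (simp add: plus_padic_int.rep_eq one_padic_int.rep_eq mod_simps)
qed

instance padic_int :: (prime_card) idom
proof
  fix x y :: "'a padic_int"
  assume x: "x \<noteq> 0" and y: "y \<noteq> 0"
  let ?q = "int CARD('a)" and ?f = "Rep_padic_int x" and ?g = "Rep_padic_int y"
  have f: "\<forall>n. ?f (Suc n) mod ?q ^ n = ?f n" and g: "\<forall>n. ?g (Suc n) mod ?q ^ n = ?g n"
    using Rep_padic_int[of x] Rep_padic_int[of y] by auto
  obtain n where n: "?f n \<noteq> 0"
    using x by (metis Rep_padic_int_inject ext zero_padic_int.rep_eq)
  obtain m where m: "?g m \<noteq> 0"
    using y by (metis Rep_padic_int_inject ext zero_padic_int.rep_eq)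
  have fn: "\<not> ?q ^ n dvd ?f (n + m)"
    using n coherent_lift_mod[OF f, of n m] by auto
  have gm: "\<not> ?q ^ m dvd ?g (n + m)"
    using m coherent_lift_mod[OF g, of m n] by (auto simp: add.commute)
  have "\<not> ?q ^ (n + m) dvd ?f (n + m) * ?g (n + m)"
  proof
    assume "?q ^ (n + m) dvd ?f (n + m) * ?g (n + m)"
    then obtain i j where ij: "i + j = n + m" "?q ^ i dvd ?f (n + m)" "?q ^ j dvd ?g (n + m)"
      using prime_elem_power_dvd_prod prime_card_int[where 'a = 'a] prime_imp_prime_elem by blast
    then have "n \<le> i \<or> m \<le> j" by linarith
    then show False using ij fn gm by (meson dvd_trans le_imp_power_dvd)
  qed
  then have "Rep_padic_int (x * y) (n + m) \<noteq> 0"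
    by (simp add: times_padic_int.rep_eq dvd_eq_mod_eq_0)
  then show "x * y \<noteq> 0"
    by (auto simp: zero_padic_int.rep_eq)
qed

instance padic_int :: (prime_card) ring_char_0
proof
  show "inj (of_nat :: nat \<Rightarrow> 'a padic_int)"
  proof (rule injI)
    fix k l :: nat
    assume eq: "(of_nat k :: 'a padic_int) = of_nat l"
    let ?q = "CARD('a)"
    have q: "?q > 1" using prime_gt_1_nat[OF prime_card[where 'a = 'a]] .
    have "k + l < ?q ^ (k + l)"
      using q by (simp add: power_gt_expt)
    then have "int k mod int ?q ^ (k + l) = int k" "int l mod int ?q ^ (k + l) = int l"
      by (auto intro!: mod_pos_pos_trivial simp flip: of_nat_power)
    then show "k = l"
      using arg_cong[OF eq, of "\<lambda>x. Rep_padic_int x (k + l)"] by (simp add: of_nat_padic_int_rep)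
  qed
qed


section \<open>The field of \<open>p\<close>-adic numbers\<close>

type_synonym 'p padic = "'p padic_int fract"

lemma of_nat_fract_eq_to_fract: "(of_nat n :: 'a::idom fract) = to_fract (of_nat n)"
  by (induction n) simp_all

instance fract :: ("{idom, ring_char_0}") field_char_0
proof
  show "inj (of_nat :: nat \<Rightarrow> 'a fract)"
    by (rule injI) (simp add: of_nat_fract_eq_to_fract)
qed

text \<open>
  Congruence modulo \<open>p\<^sup>j\<close> in the ring of \<open>p\<close>-adic integers, for elements given in the field of
  \<open>p\<close>-adic numbers. In particular both sides are required to be \<open>p\<close>-adic integers.
\<close>

definition padic_cong :: "nat \<Rightarrow> 'p::prime_card padic \<Rightarrow> 'p padic \<Rightarrow> bool" where
  "padic_cong j x y \<longleftrightarrow>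
     (\<exists>u v. x = to_fract u \<and> y = to_fract v \<and> of_nat CARD('p) ^ j dvd u - v)"

definition padic_residue :: "'p::prime_card padic_int \<Rightarrow> nat" where
  "padic_residue a = (THE r. r < CARD('p) \<and> of_nat CARD('p) dvd a - of_nat r)"

lemma padic_residue_unique:
  fixes a :: "'p::prime_card padic_int"
  shows "\<exists>!r. r < CARD('p) \<and> of_nat CARD('p) dvd a - of_nat r"
proof -
  let ?q = "int CARD('p)" and ?f = "Rep_padic_int a"
  have q: "?q > 1" using prime_gt_1_int[OF prime_card_int[where 'a = 'p]] .
  have f: "\<forall>n. ?f (Suc n) mod ?q ^ n = ?f n" using Rep_padic_int[of a] by simp
  have range: "0 \<le> ?f n" "?f n < ?q ^ n" for n
    using coherent_mod[OF f, of n] q pos_mod_bound[of "?q ^ n" "?f n"] pos_mod_sign[of "?q ^ n" "?f n"]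
    by simp_all
  have f1: "?f (Suc n) mod ?q = ?f 1" for n
    using coherent_lift_mod[OF f, of 1 n] by simp
  define m where "m = nat (?f 1)"
  have m: "int m = ?f 1" using range[of 1] by (simp add: m_def)
  define c where "c n = ?f (Suc n) div ?q" for n
  have c: "?f (Suc n) = ?q * c n + ?f 1" for n
    unfolding c_def using f1[of n] by (metis mult_div_mod_eq)
  have c_coherent: "c (Suc n) mod ?q ^ n = c n" for n
  proof -
    have "c (Suc n) mod ?q ^ n = (?f (Suc (Suc n)) mod ?q ^ Suc n) div ?q"
      unfolding c_def using q by (simp add: div_mult1_eq zmod_zmult2_eq)
    then show ?thesis using f unfolding c_def by metis
  qed
  define b :: "'p padic_int" where "b = Abs_padic_int c"
  have b: "Rep_padic_int b = c"
    unfolding b_def by (rule Abs_padic_int_inverse) (simp add: c_coherent)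
  have "Rep_padic_int (a - of_nat m) n = Rep_padic_int (of_nat CARD('p) * b) n" for n
  proof -
    have "Rep_padic_int (a - of_nat m) n = (?f n - ?f 1) mod ?q ^ n"
      by (simp add: minus_padic_int.rep_eq of_nat_padic_int_rep m mod_simps)
    also have "\<dots> = (?f (Suc n) - ?f 1) mod ?q ^ n"
      using f by (metis mod_diff_left_eq)
    also have "\<dots> = (?q * c n) mod ?q ^ n" by (subst c) simp
    also have "\<dots> = Rep_padic_int (of_nat CARD('p) * b) n"
      by (simp add: times_padic_int.rep_eq of_nat_padic_int_rep b mod_simps)
    finally show ?thesis .
  qed
  then have "a - of_nat m = of_nat CARD('p) * b"
    by (metis Rep_padic_int_inject ext)
  moreover have "m < CARD('p)" using range[of 1] m by simp
  moreover have "r = m"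
    if r: "r < CARD('p)" and dvd: "of_nat CARD('p) dvd a - of_nat r" for r
  proof -
    obtain d where "a - of_nat r = of_nat CARD('p) * d" using dvd by auto
    then have "a = of_nat CARD('p) * d + of_nat r" by (simp add: algebra_simps)
    then have "?f 1 = int r mod ?q"
      by (simp add: plus_padic_int.rep_eq times_padic_int.rep_eq of_nat_padic_int_rep)
    then show ?thesis using r m by simp
  qed
  ultimately show ?thesis by (metis dvd_triv_left)
qed

section \<open>Harmonic numbers, Bernoulli numbers and Bernoulli polynomials\<close>

text \<open>The library's \<open>harm\<close> is restricted to real normed fields.\<close>

definition harmonic :: "nat \<Rightarrow> 'a::field" where
  "harmonic n = (\<Sum>k\<in>{0<..n}. 1 / of_nat k)"

text \<open>
  The usual recursion \<open>B\<^sub>0 = 1\<close> and \<open>(\<Sum>k\<le>n. (n+1 choose k) * B\<^sub>k) = 0\<close> for \<open>n > 0\<close>, solved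
  for \<open>B\<^sub>n\<close>.
\<close>

fun bernoulli :: "nat \<Rightarrow> rat" where
  "bernoulli n = (if n = 0 then 1
     else - (\<Sum>k<n. of_nat (Suc n choose k) * bernoulli k) / of_nat (Suc n))"

declare bernoulli.simps [simp del]

definition bernpoly :: "nat \<Rightarrow> 'a::field_char_0 \<Rightarrow> 'a" where
  "bernpoly n x = (\<Sum>k\<le>n. of_nat (n choose k) * of_rat (bernoulli k) * x ^ (n - k))"

end

theory Submission
  imports
    Defs
    "HOL-Computational_Algebra.Formal_Power_Series"
    "HOL-Number_Theory.Modular_Inverse"
begin

text \<open>
  Write \<open>P\<^sub>k(x) = (-x choose k) (x-1 choose k)\<close>, \<open>T = \<Sum>\<^sub>k\<^sub><\<^sub>p P\<^sub>k\<close>,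
  \<open>S = \<Sum>\<^sub>k\<^sub><\<^sub>p P\<^sub>k H\<^sub>k\<close> and \<open>E(x) = \<Prod>\<^sub>0\<^sub><\<^sub>j\<^sub><\<^sub>p (1 - x\<^sup>2/j\<^sup>2)\<close>. Telescoping gives
  \<open>T(x) + T(x+1) = 2 E(x)\<close> and \<open>x (S(x) + S(x+1)) = 2 (x E(x) H\<^sub>p\<^sub>-\<^sub>1 + E(x) - T(x))\<close>.
  If \<open>x\<close> is a unit then \<open>E(x)\<close> vanishes modulo \<open>p\<^sup>2\<close>, so \<open>T(x+1) \<equiv> -T(x)\<close> and
  \<open>S(x+1) \<equiv> -S(x) - 2 T(x)/x\<close>. If \<open>p\<close> divides \<open>x\<close>, then \<open>P\<^sub>k(x) \<equiv> x/k\<close> for \<open>0 < k < p\<close>, whence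
  \<open>T(x) \<equiv> 1\<close> and \<open>S(x) \<equiv> S(1-x) \<equiv> 0\<close>. Induction on the residue of \<open>a\<close> yields the first
  congruence. The other two follow by expanding \<open>1/(a-k)\<close> around the residue and by
  \<open>B\<^sub>n(r) - B\<^sub>n = n \<Sum>\<^sub>j\<^sub><\<^sub>r j\<^sup>n\<^sup>-\<^sup>1\<close>, Fermat's little theorem and the \<open>p\<close>-integrality of \<open>B\<^sub>k\<close>
  for \<open>k < p-1\<close>.
\<close>

section \<open>Telescoping identities\<close>

definition twin_binomial :: "nat \<Rightarrow> 'a::field_char_0 \<Rightarrow> 'a" where
  "twin_binomial k a = ((- a) gchoose k) * ((a - 1) gchoose k)"

text \<open>A partial product of Euler's product for sin(pi a) / (pi a).\<close>

definition euler_prod :: "nat \<Rightarrow> 'a::field_char_0 \<Rightarrow> 'a" where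
  "euler_prod n a = (\<Prod>j=1..n. 1 - a\<^sup>2 / (of_nat j)\<^sup>2)"

lemma euler_prod_0 [simp]: "euler_prod 0 a = 1"
  by (simp add: euler_prod_def)

lemma euler_prod_Suc:
  "euler_prod (Suc n) a = euler_prod n a * (1 - a\<^sup>2 / (of_nat (Suc n))\<^sup>2)"
  by (simp add: euler_prod_def del: of_nat_Suc)

lemma harmonic_0 [simp]: "harmonic 0 = 0"
  by (simp add: harmonic_def)

lemma harmonic_Suc: "harmonic (Suc n) = harmonic n + 1 / of_nat (Suc n)"
proof -
  have "{0<..Suc n} = insert (Suc n) {0<..n}" by auto
  then show ?thesis by (simp add: harmonic_def del: of_nat_Suc)
qed

lemma twin_binomial_0 [simp]: "twin_binomial 0 a = 1"
  by (simp add: twin_binomial_def)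

lemma gbinomial_Suc_step:
  fixes a :: "'a::field_char_0"
  shows "a gchoose Suc k = (a gchoose k) * (a - of_nat k) / of_nat (Suc k)"
  using gbinomial_mult_1[of a k] by (simp add: field_simps del: of_nat_Suc)

lemma twin_binomial_rec:
  "twin_binomial (Suc k) a =
     - twin_binomial k a * (a + of_nat k) * (a - of_nat (Suc k)) / (of_nat (Suc k))\<^sup>2"
  unfolding twin_binomial_def gbinomial_Suc_step[of _ k]
  by (simp add: power2_eq_square divide_simps algebra_simps del: of_nat_Suc) (simp add: algebra_simps)

text \<open>The substitution swaps the two binomial factors. It yields the closed form at a + 1
  below, and it carries residue 1 back to residue 0 for the harmonic sum.\<close>

lemma twin_binomial_reflect: "twin_binomial k (1 - a) = twin_binomial k a"
  by (simp add: twin_binomial_def mult.commute)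

text \<open>In the product of the two binomials, (a + j)(a - j) = -j^2 (1 - a^2/j^2) for j = 1, ...,
  k; only the factors a and a - (k + 1) stay unpaired.\<close>

lemma twin_binomial_Suc:
  "twin_binomial (Suc k) a = - (a - of_nat (Suc k)) * a * euler_prod k a / (of_nat (Suc k))\<^sup>2"
proof (induction k)
  case 0
  then show ?case by (simp add: twin_binomial_rec algebra_simps)
next
  case (Suc k)
  have nz: "of_nat (Suc k) \<noteq> (0 :: 'a)" by (simp del: of_nat_Suc)
  show ?case
    unfolding twin_binomial_rec[of "Suc k"] Suc euler_prod_Suc
    using nz by (simp add: power2_eq_square divide_simps del: of_nat_Suc)
      (simp add: algebra_simps del: of_nat_Suc)
qed

text \<open>Reflection replaces a + 1 by -a, and \<open>euler_prod\<close> is even in its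
  argument.\<close>

lemma twin_binomial_Suc_shift:
  "twin_binomial (Suc k) (a + 1) = - (a + of_nat (Suc k)) * a * euler_prod k a / (of_nat (Suc k))\<^sup>2"
proof -
  have "twin_binomial (Suc k) (a + 1) = twin_binomial (Suc k) (- a)"
    using twin_binomial_reflect[of "Suc k" "- a"] by (simp add: add.commute)
  then show ?thesis
    by (simp add: twin_binomial_Suc euler_prod_def algebra_simps del: of_nat_Suc)
qed

text \<open>By the two closed forms the terms of index n + 1 add up to -2 a^2 E_n / (n + 1)^2, where
  E_n is \<open>euler_prod n a\<close>; this is exactly the increment of 2 E_n.\<close>

lemma sum_twin_binomial_shift:
  "(\<Sum>k\<le>n. twin_binomial k a) + (\<Sum>k\<le>n. twin_binomial k (a + 1)) = 2 * euler_prod n a"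
proof (induction n)
  case 0
  then show ?case by simp
next
  case (Suc n)
  have nz: "of_nat (Suc n) \<noteq> (0 :: 'a)" by (simp del: of_nat_Suc)
  have "twin_binomial (Suc n) a + twin_binomial (Suc n) (a + 1)
      = 2 * euler_prod (Suc n) a - 2 * euler_prod n a"
    unfolding twin_binomial_Suc[of n a] twin_binomial_Suc_shift euler_prod_Suc
    using nz by (simp add: power2_eq_square divide_simps del: of_nat_Suc)
      (simp add: algebra_simps del: of_nat_Suc)
  then show ?case using Suc by (simp add: algebra_simps)
qed

text \<open>Summation by parts of the previous identity against the harmonic numbers. The leftover
  -a E_n / (n + 1) equals E_(n+1) - E_n minus the term of index n + 1 at a, which brings in the
  plain sum. Keeping the factor a avoids a division.\<close>

lemma sum_twin_binomial_harmonic_shift: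
  "a * ((\<Sum>k\<le>n. twin_binomial k a * harmonic k) + (\<Sum>k\<le>n. twin_binomial k (a + 1) * harmonic k))
    = 2 * (a * euler_prod n a * harmonic n + euler_prod n a - (\<Sum>k\<le>n. twin_binomial k a))"
proof (induction n)
  case 0
  then show ?case by simp
next
  case (Suc n)
  define m where "m = (of_nat (Suc n) :: 'a)"
  have nz: "m \<noteq> 0" by (simp add: m_def del: of_nat_Suc)
  have "a * (twin_binomial (Suc n) a * harmonic (Suc n) + twin_binomial (Suc n) (a + 1) * harmonic (Suc n))
      = 2 * (a * euler_prod (Suc n) a * harmonic (Suc n) + euler_prod (Suc n) a - twin_binomial (Suc n) a)
        - 2 * (a * euler_prod n a * harmonic n + euler_prod n a)"
    unfolding twin_binomial_Suc[of n a] twin_binomial_Suc_shift euler_prod_Suc harmonic_Suc m_def[symmetric]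
    using nz by (simp add: power2_eq_square divide_simps) (simp add: algebra_simps)
  then show ?case using Suc by (simp add: algebra_simps)
qed

text \<open>The sum of H_k / k runs over the products 1/(j k) with j <= k; doubling it gives the
  full square plus the diagonal.\<close>

lemma sum_harmonic_over_index:
  "2 * (\<Sum>k\<in>{0<..n}. harmonic k / of_nat k)
     = (harmonic n)\<^sup>2 + (\<Sum>k\<in>{0<..n}. 1 / (of_nat k :: 'a::field_char_0)\<^sup>2)"
proof (induction n)
  case 0
  then show ?case by simp
next
  case (Suc n)
  have nz: "of_nat (Suc n) \<noteq> (0 :: 'a)" by (simp del: of_nat_Suc)
  have "2 * (harmonic (Suc n) / of_nat (Suc n))
      = (harmonic (Suc n))\<^sup>2 - (harmonic n)\<^sup>2 + 1 / (of_nat (Suc n) :: 'a)\<^sup>2"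
    unfolding harmonic_Suc using nz
    by (simp add: power2_eq_square divide_simps del: of_nat_Suc)
      (simp add: algebra_simps del: of_nat_Suc)
  moreover have "{0<..Suc n} = insert (Suc n) {0<..n}" by auto
  ultimately show ?case using Suc by (simp add: algebra_simps del: of_nat_Suc)
qed

section \<open>Bernoulli polynomials\<close>

definition bernoulli_fps :: "'a::field_char_0 fps" where
  "bernoulli_fps = Abs_fps (\<lambda>n. of_rat (bernoulli n) / fact n)"

lemma bernoulli_rec:
  assumes "n > 0"
  shows "(\<Sum>k\<le>n. of_nat (Suc n choose k) * bernoulli k) = 0"
proof -
  have "{..n} = insert n {..<n}" by auto
  moreover have "of_nat (Suc n) * bernoulli n = - (\<Sum>k<n. of_nat (Suc n choose k) * bernoulli k)"
    by (subst bernoulli.simps) (use assms in \<open>simp del: of_nat_Suc\<close>)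
  ultimately show ?thesis by (simp del: of_nat_Suc)
qed

text \<open>The coefficient of X^(m+1) is the sum in \<open>bernoulli_rec\<close> divided by (m +
  1)!, so the recursion becomes the generating function t / (e^t - 1) with the denominator cleared.
  For m = 0 the sum is B_0 = 1.\<close>

lemma bernoulli_fps_mult: "bernoulli_fps * (fps_exp 1 - 1) = (fps_X :: 'a::field_char_0 fps)"
proof (rule fps_ext)
  fix n
  show "fps_nth (bernoulli_fps * (fps_exp 1 - 1)) n = fps_nth (fps_X :: 'a fps) n"
  proof (cases n)
    case 0
    then show ?thesis by simp
  next
    case (Suc m)
    have "fps_nth (bernoulli_fps * (fps_exp 1 - 1)) n
        = (\<Sum>i\<le>m. of_rat (bernoulli i) / fact i * (1 / fact (Suc m - i)) :: 'a)"
      unfolding fps_mult_nth Suc bernoulli_fps_def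
      by (simp add: atLeast0AtMost atMost_Suc mult.commute)
    also have "\<dots> = (\<Sum>i\<le>m. of_rat (of_nat (Suc m choose i) * bernoulli i) / fact (Suc m))"
      by (intro sum.cong refl)
        (simp only: of_rat_mult of_rat_of_nat_eq, simp add: binomial_fact mult.commute del: fact_Suc)
    also have "\<dots> = of_rat (\<Sum>i\<le>m. of_nat (Suc m choose i) * bernoulli i) / fact (Suc m)"
      by (simp add: of_rat_sum sum_divide_distrib del: fact_Suc)
    also have "\<dots> = fps_nth (fps_X :: 'a fps) n"
      using bernoulli_rec[of m] by (cases "m = 0") (auto simp: Suc bernoulli.simps)
    finally show ?thesis .
  qed
qed

lemma bernpoly_fps:
  "Abs_fps (\<lambda>n. bernpoly n x / fact n) = bernoulli_fps * fps_exp (x :: 'a::field_char_0)"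
proof (rule fps_ext)
  fix n
  show "fps_nth (Abs_fps (\<lambda>n. bernpoly n x / fact n)) n = fps_nth (bernoulli_fps * fps_exp x) n"
    unfolding fps_mult_nth bernpoly_def bernoulli_fps_def
    by (simp add: sum_divide_distrib atLeast0AtMost binomial_fact)
qed

text \<open>Raising x by 1 multiplies the generating function by e^t, so the difference is t e^(x
  t); its coefficients are compared.\<close>

lemma bernpoly_diff:
  "bernpoly (Suc n) (x + 1) - bernpoly (Suc n) x = of_nat (Suc n) * (x :: 'a::field_char_0) ^ n"
proof -
  have "Abs_fps (\<lambda>n. bernpoly n (x + 1) / fact n) - Abs_fps (\<lambda>n. bernpoly n x / fact n)
      = bernoulli_fps * (fps_exp 1 - 1) * fps_exp x"
    by (simp add: bernpoly_fps fps_exp_add_mult algebra_simps)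
  also have "\<dots> = fps_X * fps_exp x" by (simp add: bernoulli_fps_mult)
  finally have "fps_nth (Abs_fps (\<lambda>n. bernpoly n (x + 1) / fact n) - Abs_fps (\<lambda>n. bernpoly n x / fact n)) (Suc n)
      = fps_nth (fps_X * fps_exp x) (Suc n)" by simp
  then have "(bernpoly (Suc n) (x + 1) - bernpoly (Suc n) x) / fact (Suc n) = x ^ n / fact n"
    by (simp add: diff_divide_distrib del: fact_Suc)
  also have "x ^ n / fact n = of_nat (Suc n) * x ^ n / fact (Suc n)"
    by (simp del: of_nat_Suc)
  finally show ?thesis by (simp del: fact_Suc of_nat_Suc)
qed

lemma bernpoly_0: "bernpoly n 0 = (of_rat (bernoulli n) :: 'a::field_char_0)"
proof -
  have "bernpoly n 0 = (\<Sum>k\<le>n. if k = n then of_rat (bernoulli n) else (0::'a))"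
    unfolding bernpoly_def by (intro sum.cong) auto
  then show ?thesis by simp
qed

lemma bernpoly_of_nat:
  "bernpoly (Suc n) (of_nat r) - of_rat (bernoulli (Suc n))
     = (of_nat (Suc n) * (\<Sum>j<r. of_nat j ^ n) :: 'a::field_char_0)"
proof (induction r)
  case 0
  then show ?case by (simp add: bernpoly_0)
next
  case (Suc r)
  then show ?case using bernpoly_diff[of n "of_nat r :: 'a"] by (simp add: algebra_simps)
qed

text \<open>The generating function F satisfies F(-t) = F(t) + t, so its odd coefficients vanish
  apart from that of t.\<close>

lemma bernoulli_odd_eq_0:
  assumes "odd n" "n \<noteq> 1"
  shows "bernoulli n = 0"
proof -
  let ?F = "bernoulli_fps :: rat fps" and ?E = "fps_exp 1 :: rat fps"
  define G where "G = ?F oo (- fps_X)"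
  have "(?F * (?E - 1)) oo (- fps_X) = fps_X oo (- fps_X)"
    by (simp only: bernoulli_fps_mult)
  then have "G * (fps_exp (- 1) - 1) = - fps_X"
    by (simp add: fps_compose_mult_distrib fps_compose_sub_distrib G_def)
  \<comment> \<open>Multiplying by e^t turns e^(-t) - 1 into 1 - e^t, so that G and F can be
    compared after cancelling the common nonzero factor e^t - 1.\<close>
  then have "G * (fps_exp (- 1) - 1) * ?E = - fps_X * ?E" by simp
  moreover have "(fps_exp (- 1) - 1) * ?E = 1 - ?E"
    using fps_exp_add_mult[of "-1::rat" 1] by (simp add: algebra_simps)
  ultimately have "G * (?E - 1) = fps_X * ?E"
    by (simp add: algebra_simps)
  also have "\<dots> = (?F + fps_X) * (?E - 1)"
    using bernoulli_fps_mult[where 'a = rat] by (simp add: algebra_simps)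
  finally have "G = ?F + fps_X"
    by simp
  then have "fps_nth G n = fps_nth ?F n + fps_nth fps_X n" by simp
  moreover have "fps_nth G n = (- 1) ^ n * fps_nth ?F n"
    unfolding G_def by (simp add: fps_compose_uminus')
  ultimately show ?thesis using assms by (simp add: bernoulli_fps_def)
qed

section \<open>Congruences between \<open>p\<close>-adic integers\<close>

text \<open>The ring viewed inside its fraction field, so that integrality of a quotient becomes a
  membership with closure rules.\<close>

definition Zp :: "'p::prime_card padic set" where
  "Zp = range to_fract"

lemma to_fract_in_Zp [simp, intro]: "to_fract a \<in> Zp"
  by (simp add: Zp_def)

lemma Zp_add [simp, intro]: "x \<in> Zp \<Longrightarrow> y \<in> Zp \<Longrightarrow> x + y \<in> Zp"
  by (auto simp: Zp_def simp flip: to_fract_add)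

lemma Zp_mult [simp, intro]: "x \<in> Zp \<Longrightarrow> y \<in> Zp \<Longrightarrow> x * y \<in> Zp"
  by (auto simp: Zp_def simp flip: to_fract_mult)

lemma Zp_uminus [simp, intro]: "x \<in> Zp \<Longrightarrow> - x \<in> Zp"
  by (auto simp: Zp_def simp flip: to_fract_uminus)

lemma Zp_diff [simp, intro]: "x \<in> Zp \<Longrightarrow> y \<in> Zp \<Longrightarrow> x - y \<in> Zp"
  by (auto simp: Zp_def simp flip: to_fract_diff)

lemma Zp_0 [simp, intro]: "0 \<in> Zp"
  by (metis to_fract_0 to_fract_in_Zp)

lemma Zp_1 [simp, intro]: "1 \<in> Zp"
  by (metis to_fract_1 to_fract_in_Zp)

lemma Zp_of_nat [simp, intro]: "of_nat n \<in> Zp"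
  by (induction n) auto

lemma Zp_numeral [simp, intro]: "numeral n \<in> Zp"
  by (metis Zp_of_nat of_nat_numeral)

lemma Zp_of_int [simp, intro]: "of_int n \<in> Zp"
  by (cases n) (auto simp del: of_nat_Suc)

lemma Zp_power [simp, intro]: "x \<in> Zp \<Longrightarrow> x ^ n \<in> Zp"
  by (induction n) auto

lemma Zp_sum [intro]: "(\<And>i. i \<in> I \<Longrightarrow> f i \<in> Zp) \<Longrightarrow> sum f I \<in> Zp"
  by (induction I rule: infinite_finite_induct) auto

lemma Zp_prod [intro]: "(\<And>i. i \<in> I \<Longrightarrow> f i \<in> Zp) \<Longrightarrow> prod f I \<in> Zp"
  by (induction I rule: infinite_finite_induct) auto

lemma padic_cong_iff:
  fixes x y :: "'p::prime_card padic"
  shows "padic_cong j x y \<longleftrightarrow> x \<in> Zp \<and> y \<in> Zp \<and> (\<exists>z\<in>Zp. x - y = of_nat CARD('p) ^ j * z)"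
proof
  assume "padic_cong j x y"
  then obtain u v w where *: "x = to_fract u" "y = to_fract v" "u - v = of_nat CARD('p) ^ j * w"
    unfolding padic_cong_def by auto
  have "to_fract (of_nat CARD('p) ^ j) = (of_nat CARD('p) ^ j :: 'p padic)"
    by (induction j) (simp_all add: of_nat_fract_eq_to_fract)
  then have "x - y = of_nat CARD('p) ^ j * to_fract w"
    using * by (metis to_fract_diff to_fract_mult)
  then show "x \<in> Zp \<and> y \<in> Zp \<and> (\<exists>z\<in>Zp. x - y = of_nat CARD('p) ^ j * z)"
    using * by auto
next
  assume "x \<in> Zp \<and> y \<in> Zp \<and> (\<exists>z\<in>Zp. x - y = of_nat CARD('p) ^ j * z)"
  then obtain u v w where *: "x = to_fract u" "y = to_fract v"
      "x - y = of_nat CARD('p) ^ j * to_fract w"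
    unfolding Zp_def by auto
  have "to_fract (of_nat CARD('p) ^ j) = (of_nat CARD('p) ^ j :: 'p padic)"
    by (induction j) (simp_all add: of_nat_fract_eq_to_fract)
  then have "to_fract (u - v) = to_fract (of_nat CARD('p) ^ j * w)"
    using * by simp
  then have "u - v = of_nat CARD('p) ^ j * w"
    by (simp only: to_fract_eq_iff)
  then show "padic_cong j x y"
    unfolding padic_cong_def using *(1,2) by auto
qed

lemma padic_cong_in_Zp:
  assumes "padic_cong j x y"
  shows "x \<in> Zp" "y \<in> Zp"
  using assms by (auto simp: padic_cong_iff)

lemma padic_cong_refl [simp, intro]: "x \<in> Zp \<Longrightarrow> padic_cong j x x"
  by (auto simp: padic_cong_iff intro!: bexI[of _ 0])

lemma padic_cong_add:
  assumes "padic_cong j x y" "padic_cong j x' y'"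
  shows "padic_cong j (x + x') (y + y')"
proof -
  obtain z z' where "z \<in> Zp" "z' \<in> Zp" "x - y = of_nat CARD('a) ^ j * z" "x' - y' = of_nat CARD('a) ^ j * z'"
    using assms by (auto simp: padic_cong_iff)
  then have "x + x' - (y + y') = of_nat CARD('a) ^ j * (z + z')" "z + z' \<in> Zp"
    by (auto simp: algebra_simps)
  then show ?thesis using assms unfolding padic_cong_iff by blast
qed

lemma padic_cong_mult:
  assumes "padic_cong j x y" "padic_cong j x' y'"
  shows "padic_cong j (x * x') (y * y')"
proof -
  obtain z z' where z: "z \<in> Zp" "z' \<in> Zp" "x - y = of_nat CARD('a) ^ j * z" "x' - y' = of_nat CARD('a) ^ j * z'"
    using assms by (auto simp: padic_cong_iff)
  have "x * x' - y * y' = (x - y) * x' + y * (x' - y')" by (simp add: algebra_simps)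
  also have "\<dots> = of_nat CARD('a) ^ j * (z * x' + y * z')"
    unfolding z by (simp add: algebra_simps)
  finally show ?thesis using assms z(1,2) unfolding padic_cong_iff by blast
qed

lemma padic_cong_uminus:
  assumes "padic_cong j x y"
  shows "padic_cong j (- x) (- y)"
  using padic_cong_mult[OF padic_cong_refl[of "-1"] assms] by simp

lemma padic_cong_sym:
  assumes "padic_cong j x y"
  shows "padic_cong j y x"
proof -
  have xy: "x \<in> Zp" "y \<in> Zp" using assms by (auto dest: padic_cong_in_Zp)
  have "padic_cong j (- x + (x + y)) (- y + (x + y))"
    using xy by (intro padic_cong_add padic_cong_uminus assms) auto
  then show ?thesis by simp
qed

lemma padic_cong_diff:
  assumes "padic_cong j x y" "padic_cong j x' y'"
  shows "padic_cong j (x - x') (y - y')"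
  using padic_cong_add[OF assms(1) padic_cong_uminus[OF assms(2)]] by simp

lemma padic_cong_trans [trans]:
  assumes "padic_cong j x y" "padic_cong j y z"
  shows "padic_cong j x z"
  using padic_cong_diff[OF padic_cong_add[OF assms] padic_cong_refl[of y]] assms
  by (auto dest: padic_cong_in_Zp)

lemma padic_cong_power: "padic_cong j x y \<Longrightarrow> padic_cong j (x ^ n) (y ^ n)"
  by (induction n) (auto intro: padic_cong_mult)

lemma padic_cong_sum:
  "(\<And>i. i \<in> I \<Longrightarrow> padic_cong j (f i) (g i)) \<Longrightarrow> padic_cong j (sum f I) (sum g I)"
  by (induction I rule: infinite_finite_induct) (auto intro: padic_cong_add)

lemma padic_cong_prod:
  "(\<And>i. i \<in> I \<Longrightarrow> padic_cong j (f i) (g i)) \<Longrightarrow> padic_cong j (prod f I) (prod g I)"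
  by (induction I rule: infinite_finite_induct) (auto intro: padic_cong_mult)

lemma padic_cong_mono:
  assumes "padic_cong j x y" "i \<le> j"
  shows "padic_cong i x y"
proof -
  obtain z where z: "z \<in> Zp" "x - y = of_nat CARD('a) ^ j * z"
    using assms by (auto simp: padic_cong_iff)
  then have "x - y = of_nat CARD('a) ^ i * (of_nat CARD('a) ^ (j - i) * z)"
    using assms(2) by (simp flip: power_add mult.assoc)
  moreover have "of_nat CARD('a) ^ (j - i) * z \<in> Zp" using z by auto
  ultimately show ?thesis using assms unfolding padic_cong_iff by blast
qed

text \<open>The source of precision modulo p^2 below: a multiplier divisible by p promotes a
  congruence modulo p.\<close>

lemma padic_cong_scale:
  assumes "padic_cong i c 0" "padic_cong j x y"
  shows "padic_cong (i + j) (c * x) (c * y)"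
proof -
  obtain z w where z: "z \<in> Zp" "w \<in> Zp" "x - y = of_nat CARD('a) ^ j * z" "c = of_nat CARD('a) ^ i * w"
    using assms by (auto simp: padic_cong_iff)
  have "c * x - c * y = c * (x - y)" by (simp add: algebra_simps)
  also have "\<dots> = of_nat CARD('a) ^ (i + j) * (w * z)"
    unfolding z by (simp add: power_add)
  finally show ?thesis using assms z(1,2) unfolding padic_cong_iff by blast
qed

lemma padic_cong_scale_1:
  "padic_cong 1 c 0 \<Longrightarrow> padic_cong 1 x y \<Longrightarrow> padic_cong 2 (c * x) (c * y)"
  using padic_cong_scale[of 1 c 1 x y] by (simp add: numeral_2_eq_2)

lemma padic_cong_of_nat:
  assumes "[m = n] (mod CARD('p) ^ j)"
  shows "padic_cong j (of_nat m :: 'p::prime_card padic) (of_nat n)"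
proof -
  have "[int m = int n] (mod int (CARD('p) ^ j))"
    using assms by (simp only: cong_int_iff)
  then obtain k where "int m - int n = int (CARD('p) ^ j) * k"
    by (auto simp: cong_iff_dvd_diff)
  then have "of_int (int m - int n) = (of_int (int (CARD('p) ^ j) * k) :: 'p padic)"
    by simp
  then have "of_nat m - of_nat n = (of_nat CARD('p) ^ j * of_int k :: 'p padic)"
    by simp
  then show ?thesis unfolding padic_cong_iff by blast
qed

section \<open>Units and inverses\<close>

lemma padic_int_invertible:
  fixes u :: "'p::prime_card padic_int"
  assumes "of_nat CARD('p) dvd u - of_nat r" and "\<not> CARD('p) dvd r"
  shows "\<exists>v. u * v = 1"
proof -
  let ?q = "int CARD('p)" and ?f = "Rep_padic_int u"
  have q: "prime ?q" by (rule prime_card_int)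
  have f: "?f (Suc n) mod ?q ^ n = ?f n" for n
    using Rep_padic_int[of u] by simp
  obtain d where "u - of_nat r = of_nat CARD('p) * d" using assms(1) by auto
  then have "u = of_nat CARD('p) * d + of_nat r" by (simp add: algebra_simps)
  then have fn: "?f n = (?q * Rep_padic_int d n + int r) mod ?q ^ n" for n
    by (simp add: plus_padic_int.rep_eq times_padic_int.rep_eq of_nat_padic_int_rep mod_simps)
  \<comment> \<open>At each positive level the representative is r modulo p, hence prime to p; at
    level 0 the modulus is 1.\<close>
  have coprime: "coprime (?f n) (?q ^ n)" for n
  proof (cases n)
    case (Suc m)
    have "?f n mod ?q = int r mod ?q"
      unfolding fn using Suc by (simp add: mod_mod_cancel)
    then have "\<not> ?q dvd ?f n"
      using assms(2) by (metis dvd_eq_mod_eq_0 int_dvd_int_iff)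
    then have "coprime (?f n) ?q"
      using prime_imp_coprime[OF q] coprime_commute by blast
    then show ?thesis by simp
  qed simp
  \<comment> \<open>The inverse is built level by level; the levels fit together because an inverse
    modulo p^n is unique in the range from 0 to p^n - 1.\<close>
  define g where "g n = modular_inverse (?q ^ n) (?f n)" for n
  have pos: "?q ^ n > 0" for n by simp
  have g: "[?f n * g n = 1] (mod ?q ^ n)" for n
    unfolding g_def using coprime by (rule cong_modular_inverse1)
  have "g (Suc n) mod ?q ^ n = g n" for n
  proof -
    have "[?f (Suc n) * g (Suc n) = 1] (mod ?q ^ n)"
      using g[of "Suc n"] by (rule cong_dvd_modulus) (simp add: le_imp_power_dvd)
    then have "[?f n * (g (Suc n) mod ?q ^ n) = 1] (mod ?q ^ n)"
      using f[of n] unfolding cong_def by (metis mod_mult_eq mod_mod_trivial)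
    moreover have "g (Suc n) mod ?q ^ n \<in> {0..<?q ^ n}"
      using pos[of n] by simp
    ultimately show ?thesis
      unfolding g_def[of n] by (intro modular_inverse_int_eqI[symmetric])
  qed
  then have v: "Rep_padic_int (Abs_padic_int g :: 'p padic_int) = g"
    by (intro Abs_padic_int_inverse) simp
  have "u * Abs_padic_int g = 1"
    using g by (intro iffD1[OF Rep_padic_int_inject] ext)
      (simp add: times_padic_int.rep_eq one_padic_int.rep_eq v cong_def)
  then show ?thesis by blast
qed

lemma padic_unit:
  fixes x :: "'p::prime_card padic"
  assumes "padic_cong 1 x (of_nat r)" and "\<not> CARD('p) dvd r"
  shows "x \<noteq> 0" and "1 / x \<in> Zp"
proof -
  obtain u v where *: "x = to_fract u" "of_nat r = (to_fract v :: 'p padic)"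
      "of_nat CARD('p) dvd u - v"
    using assms(1) by (auto simp: padic_cong_def)
  have "v = of_nat r" using *(2) by (simp add: of_nat_fract_eq_to_fract)
  then obtain w where "u * w = 1"
    using padic_int_invertible[of u r] *(3) assms(2) by auto
  then have xw: "x * to_fract w = 1"
    unfolding * by (metis to_fract_1 to_fract_mult)
  then show "x \<noteq> 0" by auto
  then have "1 / x = to_fract w" using xw by (simp add: field_simps)
  then show "1 / x \<in> Zp" by simp
qed

lemma inverse_of_nat_in_Zp:
  assumes "0 < k" "k < CARD('p)"
  shows "1 / (of_nat k :: 'p::prime_card padic) \<in> Zp"
  using assms by (intro padic_unit(2)[of _ k]) (auto dest: dvd_imp_le)

lemma padic_cong_inverse:
  assumes "padic_cong j x y" "x \<noteq> 0" "y \<noteq> 0" "1 / x \<in> Zp" "1 / y \<in> Zp"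
  shows "padic_cong j (1 / x) (1 / y)"
proof -
  have "padic_cong j (y * (1 / x * (1 / y))) (x * (1 / x * (1 / y)))"
    using assms by (intro padic_cong_mult padic_cong_sym[OF assms(1)]) auto
  then show ?thesis using assms(2,3) by simp
qed

lemma padic_cong_cancel:
  assumes "padic_cong j (c * x) (c * y)" "c \<noteq> 0" "1 / c \<in> Zp"
  shows "padic_cong j x y"
  using padic_cong_mult[OF padic_cong_refl[OF assms(3)] assms(1)] assms(2) by simp

section \<open>Residues modulo p\<close>

lemma padic_cong_residue: "padic_cong 1 (to_fract a) (of_nat (padic_residue a))"
  and padic_residue_less: "padic_residue (a :: 'p::prime_card padic_int) < CARD('p)"
proof -
  have *: "padic_residue a < CARD('p) \<and> of_nat CARD('p) dvd a - of_nat (padic_residue a)"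
    unfolding padic_residue_def by (rule theI'[OF padic_residue_unique])
  then show "padic_residue a < CARD('p)" by blast
  show "padic_cong 1 (to_fract a) (of_nat (padic_residue a))"
    unfolding padic_cong_def using * by (auto simp: of_nat_fract_eq_to_fract)
qed

lemma padic_residue_eqI:
  fixes a :: "'p::prime_card padic_int"
  assumes "padic_cong 1 (to_fract a) (of_nat r)" "r < CARD('p)"
  shows "padic_residue a = r"
proof -
  have "of_nat CARD('p) dvd a - of_nat r"
    using assms(1) unfolding padic_cong_def by (auto simp: of_nat_fract_eq_to_fract)
  then show ?thesis
    unfolding padic_residue_def using assms(2) padic_residue_unique[of a] by (auto intro: the1_equality)
qed

section \<open>Congruences for Euler products, binomial coefficients and Bernoulli polynomials\<close>

lemma harmonic_in_Zp:
  assumes "n < CARD('p)"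
  shows "(harmonic n :: 'p::prime_card padic) \<in> Zp"
  unfolding harmonic_def using assms by (intro Zp_sum inverse_of_nat_in_Zp) auto

lemma inverse_square_in_Zp:
  assumes "0 < k" "k < CARD('p)"
  shows "1 / (of_nat k :: 'p::prime_card padic)\<^sup>2 \<in> Zp"
  using Zp_power[OF inverse_of_nat_in_Zp[OF assms], of 2] by (simp add: power_divide)

lemma euler_prod_in_Zp:
  fixes x :: "'p::prime_card padic"
  assumes "x \<in> Zp" "n < CARD('p)"
  shows "euler_prod n x \<in> Zp"
  unfolding euler_prod_def
proof (rule Zp_prod)
  fix j assume "j \<in> {1..n}"
  then have "x\<^sup>2 * (1 / (of_nat j)\<^sup>2) \<in> Zp"
    using assms by (intro Zp_mult inverse_square_in_Zp) auto
  then show "1 - x\<^sup>2 / (of_nat j)\<^sup>2 \<in> Zp" by auto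
qed

text \<open>Only x^2 enters the factors, and it is already divisible by p^2.\<close>

lemma euler_prod_cong_1:
  fixes x :: "'p::prime_card padic"
  assumes "padic_cong 1 x 0" "n < CARD('p)"
  shows "padic_cong 2 (euler_prod n x) 1"
proof -
  have "padic_cong 2 (\<Prod>j=1..n. 1 - x\<^sup>2 / (of_nat j)\<^sup>2) (\<Prod>j=1..n. 1)"
  proof (rule padic_cong_prod)
    fix j assume j: "j \<in> {1..n}"
    have "padic_cong 2 (x\<^sup>2) 0"
      using padic_cong_scale_1[OF assms(1) assms(1)] by (simp add: power2_eq_square)
    then have "padic_cong 2 (1 - x\<^sup>2 * (1 / (of_nat j)\<^sup>2)) (1 - 0 * (1 / (of_nat j)\<^sup>2))"
      using j assms(2) by (intro padic_cong_diff padic_cong_mult padic_cong_refl inverse_square_in_Zp) auto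
    then show "padic_cong 2 (1 - x\<^sup>2 / (of_nat j)\<^sup>2) 1"
      by simp
  qed
  then show ?thesis by (simp add: euler_prod_def)
qed

lemma euler_factor_cong_0:
  fixes x :: "'p::prime_card padic"
  assumes "padic_cong 1 x (of_nat k) \<or> padic_cong 1 x (- of_nat k)" "0 < k" "k < CARD('p)"
  shows "padic_cong 1 (1 - x\<^sup>2 / (of_nat k)\<^sup>2) 0"
proof -
  have "padic_cong 1 (x\<^sup>2) ((of_nat k)\<^sup>2)"
    using assms(1) padic_cong_power[of 1 x _ 2] by force
  then have "padic_cong 1 (1 - x\<^sup>2 * (1 / (of_nat k)\<^sup>2)) (1 - (of_nat k)\<^sup>2 * (1 / (of_nat k)\<^sup>2))"
    using assms by (intro padic_cong_diff padic_cong_mult padic_cong_refl inverse_square_in_Zp) auto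
  then show ?thesis using assms(2) by simp
qed

text \<open>For a unit \<open>x \<equiv> r\<close> two different factors, at \<open>j = r\<close> and \<open>j = p - r\<close>, are divisible by \<open>p\<close>.\<close>

lemma euler_prod_cong_0:
  fixes x :: "'p::prime_card padic"
  assumes "padic_cong 1 x (of_nat r)" "0 < r" "r < CARD('p)" "odd CARD('p)"
  shows "padic_cong 2 (euler_prod (CARD('p) - 1) x) 0"
proof -
  let ?p = "CARD('p)" and ?f = "\<lambda>j. 1 - x\<^sup>2 / (of_nat j)\<^sup>2"
  define s where "s = ?p - r"
  have s: "0 < s" "s < ?p" "?p = r + s"
    using assms by (auto simp: s_def)
  \<comment> \<open>Equality would make p = 2 r even; the two factors divisible by p are therefore
    distinct.\<close>
  have "s \<noteq> r" using assms(4) s(3) by auto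
  have "padic_cong 1 (of_nat r + of_nat s :: 'p padic) 0"
    using padic_cong_of_nat[of ?p 0 1, where 'p = 'p] s(3) by (simp add: cong_def)
  from padic_cong_diff[OF this padic_cong_refl[of "of_nat s"]]
  have "padic_cong 1 (of_nat r :: 'p padic) (- of_nat s)" by simp
  with assms(1) have xs: "padic_cong 1 x (- of_nat s)" by (rule padic_cong_trans)
  have fr: "padic_cong 1 (?f r) 0" and fs: "padic_cong 1 (?f s) 0"
    using assms(1-3) s xs euler_factor_cong_0[of x r] euler_factor_cong_0[of x s] by blast+
  have x: "x \<in> Zp" using assms(1) by (auto dest: padic_cong_in_Zp)
  have rest: "prod ?f ({1..?p - 1} - {r} - {s}) \<in> Zp"
  proof (rule Zp_prod)
    fix j assume "j \<in> {1..?p - 1} - {r} - {s}"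
    then have "x\<^sup>2 * (1 / (of_nat j)\<^sup>2) \<in> Zp"
      using x by (intro Zp_mult inverse_square_in_Zp) auto
    then show "?f j \<in> Zp" by auto
  qed
  have "euler_prod (?p - 1) x = ?f r * prod ?f ({1..?p - 1} - {r})"
    unfolding euler_prod_def using assms by (intro prod.remove) auto
  also have "prod ?f ({1..?p - 1} - {r}) = ?f s * prod ?f ({1..?p - 1} - {r} - {s})"
    using s \<open>s \<noteq> r\<close> by (intro prod.remove) auto
  finally have "euler_prod (?p - 1) x = ?f r * ?f s * prod ?f ({1..?p - 1} - {r} - {s})"
    by (simp only: mult.assoc)
  moreover have "padic_cong 2 (?f r * ?f s * prod ?f ({1..?p - 1} - {r} - {s}))
      (?f r * 0 * prod ?f ({1..?p - 1} - {r} - {s}))"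
    by (intro padic_cong_mult padic_cong_refl rest padic_cong_scale_1 fr fs)
  ultimately show ?thesis by simp
qed

text \<open>With y = x/k the closed form reads y (1 - y) E_(k-1)(x). The last two factors multiply
  to 1 modulo p, and y is divisible by p.\<close>

lemma twin_binomial_cong:
  fixes x :: "'p::prime_card padic"
  assumes "padic_cong 1 x 0" "0 < k" "k < CARD('p)"
  shows "padic_cong 2 (twin_binomial k x) (x / of_nat k)"
proof -
  obtain m where m: "k = Suc m" using assms(2) by (cases k) auto
  define y where "y = x / of_nat k"
  have "padic_cong 1 (x * (1 / of_nat k)) (0 * (1 / of_nat k))"
    using assms by (intro padic_cong_mult padic_cong_refl inverse_of_nat_in_Zp)
  then have y: "padic_cong 1 y 0" by (simp add: y_def)
  have "padic_cong 1 ((1 - y) * euler_prod m x) ((1 - 0) * 1)"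
    using assms m y by (intro padic_cong_mult padic_cong_diff padic_cong_refl
      padic_cong_mono[OF euler_prod_cong_1]) auto
  from padic_cong_scale_1[OF y this] have "padic_cong 2 (y * ((1 - y) * euler_prod m x)) y"
    by simp
  moreover have "twin_binomial k x = y * ((1 - y) * euler_prod m x)"
    using assms(2) unfolding m twin_binomial_Suc y_def
    by (simp add: power2_eq_square divide_simps del: of_nat_Suc)
  ultimately show ?thesis by (simp add: y_def)
qed

section \<open>Bernoulli polynomials and power sums modulo p\<close>

lemma bernoulli_in_Zp:
  assumes "n < CARD('p) - 1"
  shows "(of_rat (bernoulli n) :: 'p::prime_card padic) \<in> Zp"
  using assms
proof (induction n rule: less_induct)
  case (less n)
  show ?case
  proof (cases "n = 0")
    case True
    then show ?thesis by (simp add: bernoulli.simps)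
  next
    case False
    have "(of_rat (bernoulli n) :: 'p padic)
        = - (\<Sum>k<n. of_nat (Suc n choose k) * of_rat (bernoulli k)) * (1 / of_nat (Suc n))"
      by (subst bernoulli.simps)
        (use False in \<open>simp add: of_rat_divide of_rat_minus of_rat_sum of_rat_mult del: of_nat_Suc binomial_Suc_Suc\<close>)
    \<comment> \<open>The bound n < p - 1 keeps the divisor n + 1 below p, hence a unit.\<close>
    also have "\<dots> \<in> Zp"
      using less by (intro Zp_mult Zp_uminus Zp_sum Zp_of_nat inverse_of_nat_in_Zp) auto
    finally show ?thesis .
  qed
qed

text \<open>Subtracting the constant term removes B_n, which is not p-integral for n = p - 1; if n <
  p, every remaining coefficient is covered by \<open>bernoulli_in_Zp\<close>.\<close>

lemma bernpoly_diff_bernoulli: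
  "bernpoly n x - of_rat (bernoulli n)
     = (\<Sum>k<n. of_nat (n choose k) * of_rat (bernoulli k) * x ^ (n - k))"
proof -
  have "{..n} = insert n {..<n}" by auto
  then show ?thesis by (simp add: bernpoly_def)
qed

lemma bernpoly_cong:
  fixes x :: "'p::prime_card padic"
  assumes "padic_cong j x y" "n < CARD('p)"
  shows "padic_cong j (bernpoly n x - of_rat (bernoulli n)) (bernpoly n y - of_rat (bernoulli n))"
  unfolding bernpoly_diff_bernoulli using assms
  by (intro padic_cong_sum padic_cong_mult padic_cong_refl padic_cong_power Zp_mult Zp_of_nat bernoulli_in_Zp)
    auto

text \<open>Fermat's k^(p-1) = 1 modulo p, divided by k^i.\<close>

lemma power_cong_inverse:
  assumes "0 < k" "k < CARD('p)" "i < CARD('p)"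
  shows "padic_cong 1 (of_nat k ^ (CARD('p) - 1 - i)) (1 / (of_nat k :: 'p::prime_card padic) ^ i)"
proof -
  let ?p = "CARD('p)"
  have "[k ^ (?p - 1) = 1] (mod ?p ^ 1)"
    using fermat_theorem[OF prime_card[where 'a = 'p], of k] assms nat_dvd_not_less[of k "CARD('p)"] by simp
  from padic_cong_of_nat[OF this]
  have "padic_cong 1 ((of_nat k :: 'p padic) ^ (?p - 1)) 1" by simp
  from padic_cong_mult[OF this padic_cong_refl[OF Zp_power[OF inverse_of_nat_in_Zp[OF assms(1,2)], of i]]]
  have "padic_cong 1 ((of_nat k :: 'p padic) ^ (?p - 1) * (1 / of_nat k) ^ i) ((1 / of_nat k) ^ i)"
    by simp
  moreover have "?p - 1 = (?p - 1 - i) + i" using assms(3) by simp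
  then have "(of_nat k :: 'p padic) ^ (?p - 1) = of_nat k ^ (?p - 1 - i) * of_nat k ^ i"
    by (metis power_add)
  ultimately show ?thesis using assms(1) by (simp add: power_divide)
qed

text \<open>For m = p - 1 - i the difference at r is m + 1 times a sum of m-th powers. Here m + 1 =
  p - i is -i modulo p, and Fermat turns j^m into 1/j^i. The value r = p is allowed for the sake of
  the next lemma.\<close>

lemma bernpoly_cong_power_sum:
  fixes x :: "'p::prime_card padic"
  assumes "padic_cong 1 x (of_nat r)" "r \<le> CARD('p)" "0 < i" "i < CARD('p) - 1"
  shows "padic_cong 1 (bernpoly (CARD('p) - i) x - of_rat (bernoulli (CARD('p) - i)))
           (- of_nat i * (\<Sum>k\<in>{0<..<r}. 1 / of_nat k ^ i))"
proof -
  let ?p = "CARD('p)"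
  define m where "m = ?p - 1 - i"
  have m: "?p - i = Suc m" "0 < m" using assms by (auto simp: m_def)
  have "padic_cong 1 (of_nat i + of_nat (Suc m) :: 'p padic) 0"
    using padic_cong_of_nat[of ?p 0 1, where 'p = 'p] m(1) assms(4)
    by (simp add: cong_def flip: of_nat_add m(1))
  from padic_cong_diff[OF this padic_cong_refl[of "of_nat i"]]
  have i: "padic_cong 1 (of_nat (Suc m) :: 'p padic) (- of_nat i)" by simp
  have "padic_cong 1 (bernpoly (Suc m) x - of_rat (bernoulli (Suc m)))
      (bernpoly (Suc m) (of_nat r) - of_rat (bernoulli (Suc m)))"
    using assms m by (intro bernpoly_cong) auto
  also have "bernpoly (Suc m) (of_nat r) - of_rat (bernoulli (Suc m))
      = of_nat (Suc m) * (\<Sum>j<r. (of_nat j :: 'p padic) ^ m)"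
    by (rule bernpoly_of_nat)
  \<comment> \<open>The term j = 0 may be dropped because m > 0.\<close>
  also have "(\<Sum>j<r. (of_nat j :: 'p padic) ^ m) = (\<Sum>j\<in>{0<..<r}. of_nat j ^ m)"
    using m(2) by (intro sum.mono_neutral_right) (auto simp: not_less)
  also have "padic_cong 1 (of_nat (Suc m) * (\<Sum>j\<in>{0<..<r}. (of_nat j :: 'p padic) ^ m))
      (- of_nat i * (\<Sum>k\<in>{0<..<r}. 1 / of_nat k ^ i))"
    unfolding m_def using assms
    by (intro padic_cong_mult padic_cong_sum power_cong_inverse i[unfolded m_def]) auto
  finally show ?thesis by (simp only: m(1))
qed

text \<open>The residue class of x = 0 is represented by r = p, which makes the sum complete while
  the Bernoulli difference is 0; then the unit i is cancelled.\<close>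

lemma inverse_power_sum_cong_0:
  assumes "0 < i" "i < CARD('p) - 1"
  shows "padic_cong 1 (\<Sum>k\<in>{0<..<CARD('p)}. 1 / (of_nat k :: 'p::prime_card padic) ^ i) 0"
proof -
  let ?p = "CARD('p)" and ?s = "\<Sum>k\<in>{0<..<CARD('p)}. 1 / (of_nat k :: 'p padic) ^ i"
  have "padic_cong 1 (0 :: 'p padic) (of_nat ?p)"
    using padic_cong_of_nat[of 0 ?p 1, where 'p = 'p] by (simp add: cong_def)
  from bernpoly_cong_power_sum[OF this _ assms]
  have "padic_cong 1 0 (- of_nat i * ?s)" by (simp add: bernpoly_0)
  then have "padic_cong 1 (of_nat i * ?s) (of_nat i * 0)"
    using padic_cong_uminus padic_cong_sym by fastforce
  then show ?thesis
    by (rule padic_cong_cancel) (use assms in \<open>auto intro!: inverse_of_nat_in_Zp\<close>)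
qed

section \<open>Congruences for the sums\<close>

lemma padic_cong_card: "padic_cong 1 (of_nat CARD('p) :: 'p::prime_card padic) 0"
  using padic_cong_of_nat[of "CARD('p)" 0 1, where 'p = 'p] by (simp add: cong_def)

lemma harmonic_card_cong_0_mod_p:
  assumes "CARD('p) > 3"
  shows "padic_cong 1 (harmonic (CARD('p) - 1) :: 'p::prime_card padic) 0"
proof -
  have "{0<..CARD('p) - 1} = {0<..<CARD('p)}" by auto
  then show ?thesis
    using inverse_power_sum_cong_0[of 1, where 'p = 'p] assms by (simp add: harmonic_def)
qed

text \<open>Wolstenholme's theorem, doubled because every pair is counted twice: 1/k + 1/(p - k) = p
  / (k (p - k)), and modulo p the cofactors sum to minus the sum of 1/k^2, which vanishes.\<close>

lemma twice_harmonic_card_cong_0: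
  assumes "CARD('p) > 3"
  shows "padic_cong 2 (2 * harmonic (CARD('p) - 1) :: 'p::prime_card padic) 0"
proof -
  let ?p = "CARD('p)" and ?i = "\<lambda>k. 1 / (of_nat k :: 'p padic)"
  have set: "{0<..?p - 1} = {0<..<?p}" by auto
  have "(\<Sum>k\<in>{0<..<?p}. ?i k) = (\<Sum>k\<in>{0<..<?p}. ?i (?p - k))"
    by (rule sum.reindex_bij_witness[of _ "\<lambda>k. ?p - k" "\<lambda>k. ?p - k"]) auto
  then have "2 * harmonic (?p - 1) = (\<Sum>k\<in>{0<..<?p}. ?i k + ?i (?p - k))"
    unfolding harmonic_def set sum.distrib mult_2 by simp
  also have "\<dots> = (\<Sum>k\<in>{0<..<?p}. of_nat ?p * (?i k * ?i (?p - k)))"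
    by (intro sum.cong refl) (simp add: field_simps of_nat_diff)
  also have "\<dots> = of_nat ?p * (\<Sum>k\<in>{0<..<?p}. ?i k * ?i (?p - k))"
    by (simp add: sum_distrib_left)
  finally have *: "2 * harmonic (?p - 1) = of_nat ?p * (\<Sum>k\<in>{0<..<?p}. ?i k * ?i (?p - k))" .
  have inv: "padic_cong 1 (?i (?p - k)) (- ?i k)" if "k \<in> {0<..<?p}" for k
  proof -
    have "padic_cong 1 (of_nat (?p - k) :: 'p padic) (- of_nat k)"
      using padic_cong_diff[OF padic_cong_card[where 'p = 'p] padic_cong_refl[of "of_nat k"]] that
      by (simp add: of_nat_diff)
    then have "padic_cong 1 (?i (?p - k)) (1 / (- of_nat k))"
      using that Zp_uminus[OF inverse_of_nat_in_Zp[of k, where 'p = 'p]]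
      by (intro padic_cong_inverse inverse_of_nat_in_Zp) auto
    then show ?thesis by simp
  qed
  have "padic_cong 1 (\<Sum>k\<in>{0<..<?p}. ?i k * ?i (?p - k)) (\<Sum>k\<in>{0<..<?p}. ?i k * (- ?i k))"
    by (intro padic_cong_sum padic_cong_mult padic_cong_refl inv inverse_of_nat_in_Zp) auto
  also have "(\<Sum>k\<in>{0<..<?p}. ?i k * (- ?i k)) = - (\<Sum>k\<in>{0<..<?p}. 1 / (of_nat k)\<^sup>2)"
    by (simp add: sum_negf power2_eq_square)
  also have "padic_cong 1 \<dots> (- 0)"
    using assms by (intro padic_cong_uminus inverse_power_sum_cong_0) auto
  finally show ?thesis
    using padic_cong_scale_1[OF padic_cong_card] unfolding * by fastforce
qed

text \<open>Both terms on the right of \<open>sum_harmonic_over_index\<close> vanish modulo p for n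
  = p - 1, and 2 is a unit.\<close>

lemma sum_harmonic_over_index_cong_0:
  assumes "CARD('p) > 3"
  shows "padic_cong 1 (\<Sum>k\<in>{0<..<CARD('p)}. harmonic k / (of_nat k :: 'p::prime_card padic)) 0"
proof -
  let ?p = "CARD('p)" and ?s = "\<Sum>k\<in>{0<..<CARD('p)}. harmonic k / (of_nat k :: 'p padic)"
  have set: "{0<..?p - 1} = {0<..<?p}" by auto
  have "2 * ?s = (harmonic (?p - 1))\<^sup>2 + (\<Sum>k\<in>{0<..<?p}. 1 / (of_nat k)\<^sup>2)"
    using sum_harmonic_over_index[of "?p - 1", where 'a = "'p padic"] by (simp only: set)
  moreover have "padic_cong 1 ((harmonic (?p - 1) :: 'p padic)\<^sup>2 + (\<Sum>k\<in>{0<..<?p}. 1 / (of_nat k)\<^sup>2))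
      (0\<^sup>2 + 0)"
    using assms
    by (intro padic_cong_add padic_cong_power harmonic_card_cong_0_mod_p inverse_power_sum_cong_0) auto
  ultimately have "padic_cong 1 (2 * ?s) (2 * 0)" by simp
  then show ?thesis
    by (rule padic_cong_cancel)
      (use assms inverse_of_nat_in_Zp[of 2, where 'p = 'p] in auto)
qed

section \<open>The two sums at arguments divisible by p\<close>

lemma sum_twin_binomial_cong_1:
  fixes x :: "'p::prime_card padic"
  assumes "padic_cong 1 x 0" "CARD('p) > 3"
  shows "padic_cong 2 (\<Sum>k\<le>CARD('p) - 1. twin_binomial k x) 1"
proof -
  let ?p = "CARD('p)"
  have set: "{..?p - 1} = insert 0 {0<..<?p}" using assms(2) by auto
  have "padic_cong 2 (1 + (\<Sum>k\<in>{0<..<?p}. twin_binomial k x)) (1 + (\<Sum>k\<in>{0<..<?p}. x / of_nat k))"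
    by (intro padic_cong_add padic_cong_sum padic_cong_refl twin_binomial_cong assms) auto
  also have "(\<Sum>k\<in>{0<..<?p}. x / of_nat k) = x * (\<Sum>k\<in>{0<..<?p}. 1 / of_nat k ^ 1)"
    by (simp add: sum_distrib_left)
  \<comment> \<open>Both x and the harmonic sum are divisible by p.\<close>
  also have "padic_cong 2 (1 + \<dots>) (1 + x * 0)"
    using assms by (intro padic_cong_add padic_cong_refl padic_cong_scale_1 inverse_power_sum_cong_0) auto
  finally show ?thesis by (simp add: set del: One_nat_def)
qed

lemma sum_twin_binomial_harmonic_cong_0:
  fixes x :: "'p::prime_card padic"
  assumes "padic_cong 1 x 0" "CARD('p) > 3"
  shows "padic_cong 2 (\<Sum>k\<le>CARD('p) - 1. twin_binomial k x * harmonic k) 0"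
proof -
  let ?p = "CARD('p)"
  have set: "{..?p - 1} = insert 0 {0<..<?p}" using assms(2) by auto
  have "padic_cong 2 (\<Sum>k\<in>{0<..<?p}. twin_binomial k x * harmonic k)
      (\<Sum>k\<in>{0<..<?p}. x / of_nat k * harmonic k)"
    by (intro padic_cong_sum padic_cong_mult padic_cong_refl twin_binomial_cong harmonic_in_Zp assms) auto
  also have "(\<Sum>k\<in>{0<..<?p}. x / of_nat k * harmonic k) = x * (\<Sum>k\<in>{0<..<?p}. harmonic k / of_nat k)"
    by (simp add: sum_distrib_left)
  also have "padic_cong 2 \<dots> (x * 0)"
    by (intro padic_cong_scale_1 sum_harmonic_over_index_cong_0 assms)
  finally show ?thesis by (simp add: set del: One_nat_def)
qed

section \<open>Induction on the residue of the argument\<close>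

lemma padic_cong_diff_1:
  assumes "padic_cong j x (of_nat (Suc r))"
  shows "padic_cong j (x - 1) (of_nat r)"
  using padic_cong_diff[OF assms padic_cong_refl[of 1]] by simp

text \<open>The shift identity is used at x - 1. For residue 1, p divides x - 1 and the value is 2 *
  1 - 1; afterwards x - 1 is a unit, the Euler product vanishes and each step flips the
  sign.\<close>

lemma sum_twin_binomial_cong:
  fixes x :: "'p::prime_card padic"
  assumes "padic_cong 1 x (of_nat (Suc r))" "Suc r < CARD('p)" "CARD('p) > 3"
  shows "padic_cong 2 (\<Sum>k\<le>CARD('p) - 1. twin_binomial k x) ((- 1) ^ r)"
  using assms(1,2)
proof (induction r arbitrary: x)
  case 0
  let ?T = "\<lambda>x :: 'p padic. \<Sum>k\<le>CARD('p) - 1. twin_binomial k x"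
  have x: "padic_cong 1 (x - 1) 0"
    using padic_cong_diff_1[OF 0(1)] by simp
  have "?T (x :: 'p padic) = 2 * euler_prod (CARD('p) - 1) (x - 1) - ?T (x - 1)"
    using sum_twin_binomial_shift[where n = "CARD('p) - 1" and a = "x - 1"] by (simp add: algebra_simps)
  also have "padic_cong 2 \<dots> (2 * 1 - 1)"
    using x assms(3)
    by (intro padic_cong_diff padic_cong_mult padic_cong_refl euler_prod_cong_1 sum_twin_binomial_cong_1) auto
  finally show ?case by simp
next
  case (Suc r)
  let ?T = "\<lambda>x :: 'p padic. \<Sum>k\<le>CARD('p) - 1. twin_binomial k x"
  have x: "padic_cong 1 (x - 1) (of_nat (Suc r))"
    by (rule padic_cong_diff_1) (rule Suc.prems)
  have "?T (x :: 'p padic) = 2 * euler_prod (CARD('p) - 1) (x - 1) - ?T (x - 1)"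
    using sum_twin_binomial_shift[where n = "CARD('p) - 1" and a = "x - 1"] by (simp add: algebra_simps)
  also have "padic_cong 2 \<dots> (2 * 0 - (- 1) ^ r)"
    using x assms(3) Suc
    by (intro padic_cong_diff padic_cong_mult padic_cong_refl Suc.IH
        euler_prod_cong_0[where r = "Suc r"] prime_odd_nat[OF prime_card]) auto
  finally show ?case by simp
qed

lemma sum_inverse_shift:
  "(\<Sum>k\<in>{0<..<Suc (Suc r)}. 1 / (x - of_nat k))
     = 1 / (x - 1) + (\<Sum>k\<in>{0<..<Suc r}. 1 / (x - 1 - of_nat k :: 'a::field))"
proof -
  have "(\<Sum>k\<in>{Suc 0..<Suc (Suc r)}. 1 / (x - of_nat k))
      = 1 / (x - of_nat (Suc 0)) + (\<Sum>k\<in>{Suc (Suc 0)..<Suc (Suc r)}. 1 / (x - of_nat k))"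
    by (rule sum.atLeast_Suc_lessThan) simp
  also have "(\<Sum>k\<in>{Suc (Suc 0)..<Suc (Suc r)}. 1 / (x - of_nat k))
      = (\<Sum>k\<in>{Suc 0..<Suc r}. 1 / (x - of_nat (Suc k)))"
    by (rule sum.shift_bounds_Suc_ivl)
  finally show ?thesis
    unfolding atLeastSucLessThan_greaterThanLessThan by (simp add: diff_diff_eq)
qed

lemma sum_twin_binomial_harmonic_cong:
  fixes x :: "'p::prime_card padic"
  assumes "padic_cong 1 x (of_nat (Suc r))" "Suc r < CARD('p)" "CARD('p) > 3"
  shows "padic_cong 2 (\<Sum>k\<le>CARD('p) - 1. twin_binomial k x * harmonic k)
           ((- 1) ^ r * 2 * (\<Sum>k\<in>{0<..<Suc r}. 1 / (x - of_nat k)))"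
  using assms(1,2)
proof (induction r arbitrary: x)
  case 0
  \<comment> \<open>Here x - 1 is not a unit, so the shift identity cannot be divided by it;
    reflection to 1 - x, which p divides, replaces it.\<close>
  have "padic_cong 1 (1 - x) 0"
    using padic_cong_uminus[OF padic_cong_diff_1[OF 0(1)]] by simp
  from sum_twin_binomial_harmonic_cong_0[OF this assms(3)]
  have "padic_cong 2 (\<Sum>k\<le>CARD('p) - 1. twin_binomial k x * harmonic k) 0"
    by (simp only: twin_binomial_reflect)
  moreover have "{0<..<Suc 0} = {}" by auto
  ultimately show ?case by simp
next
  case (Suc r)
  let ?n = "CARD('p) - 1"
  let ?T = "\<lambda>x. \<Sum>k\<le>?n. twin_binomial k (x :: 'p padic)"
  let ?S = "\<lambda>x. \<Sum>k\<le>?n. twin_binomial k (x :: 'p padic) * harmonic k"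
  let ?I = "\<Sum>k\<in>{0<..<Suc r}. 1 / (x - 1 - of_nat k)"
  define y where "y = x - 1"
  have y: "padic_cong 1 y (of_nat (Suc r))"
    unfolding y_def by (rule padic_cong_diff_1) (rule Suc.prems)
  have r: "Suc r < CARD('p)" using Suc.prems by simp
  have "\<not> CARD('p) dvd Suc r" using r by (auto dest: dvd_imp_le)
  note unit = padic_unit[OF y this]
  have E: "padic_cong 2 (euler_prod ?n y) 0"
    using y r assms(3)
    by (intro euler_prod_cong_0[where r = "Suc r"] prime_odd_nat[OF prime_card]) auto
  have yZ: "y \<in> Zp" using y by (auto dest: padic_cong_in_Zp)
  \<comment> \<open>Modulo p^2 the Euler product vanishes, so only -2 T(y) is left on the right, and
    the unit y can be cancelled.\<close>
  have "y * (?S y + ?S x) = 2 * (y * euler_prod ?n y * harmonic ?n + euler_prod ?n y - ?T y)"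
    using sum_twin_binomial_harmonic_shift[of y ?n] by (simp add: y_def)
  also have "padic_cong 2 \<dots> (2 * (y * 0 * harmonic ?n + 0 - (- 1) ^ r))"
    using yZ y r assms(3)
    by (intro padic_cong_mult padic_cong_diff padic_cong_add padic_cong_refl E
        sum_twin_binomial_cong harmonic_in_Zp) auto
  finally have "padic_cong 2 (y * (?S y + ?S x)) (y * (- 2 * (- 1) ^ r * (1 / y)))"
    using unit(1) by simp
  then have *: "padic_cong 2 (?S y + ?S x) (- 2 * (- 1) ^ r * (1 / y))"
    by (rule padic_cong_cancel) (fact unit)+
  have "padic_cong 2 (?S y) ((- 1) ^ r * 2 * ?I)"
    using Suc.IH[OF y r] by (simp add: y_def)
  from padic_cong_diff[OF * this]
  have "padic_cong 2 (?S x) (- 2 * (- 1) ^ r * (1 / y) - (- 1) ^ r * 2 * ?I)"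
    by simp
  \<comment> \<open>The new term 1/y = 1/(x - 1) is the one for k = 1 in the longer sum; the old
    terms move up by one index.\<close>
  moreover have "- 2 * (- 1) ^ r * (1 / y) - (- 1) ^ r * 2 * ?I
      = (- 1) ^ Suc r * 2 * (1 / (x - 1) + ?I)"
    by (simp add: y_def algebra_simps)
  ultimately show ?case
    by (simp only: sum_inverse_shift)
qed

section \<open>First-order expansion around the residue\<close>

lemma bernpoly_card_minus_2_cong:
  fixes x :: "'p::prime_card padic"
  assumes "padic_cong 1 x (of_nat r)" "r \<le> CARD('p)" "CARD('p) > 3"
  shows "padic_cong 1 (bernpoly (CARD('p) - 2) x) (- 2 * (\<Sum>k\<in>{0<..<r}. 1 / (of_nat k)\<^sup>2))"
proof -
  \<comment> \<open>Since p - 2 is odd and at least 3, B_(p-2) = 0 and the polynomial equals its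
    difference from the constant term.\<close>
  have "odd (CARD('p) - 2)"
    using prime_odd_nat[OF prime_card[where 'a = 'p]] assms(3) by simp
  then have "bernoulli (CARD('p) - 2) = 0"
    using assms(3) by (intro bernoulli_odd_eq_0) auto
  then show ?thesis
    using bernpoly_cong_power_sum[OF assms(1,2), of 2] assms(3) by simp
qed

text \<open>Put e = x - (r + 1), so that e^2 vanishes modulo p^2. Then 1/(e + k) expands to 1/k -
  e/k^2, and the sum of -2/k^2 is identified with B_(p-2)(x).\<close>

lemma sum_inverse_cong:
  fixes x :: "'p::prime_card padic"
  assumes "padic_cong 1 x (of_nat (Suc r))" "Suc r < CARD('p)" "CARD('p) > 3"
  shows "padic_cong 2 (2 * (\<Sum>k\<in>{0<..<Suc r}. 1 / (x - of_nat k)))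
           (2 * harmonic r + (x - of_nat (Suc r)) * bernpoly (CARD('p) - 2) x)"
proof -
  let ?p = "CARD('p)"
  define e where "e = x - of_nat (Suc r)"
  have e: "padic_cong 1 e 0"
    unfolding e_def using padic_cong_diff[OF assms(1) padic_cong_refl[of "of_nat (Suc r)"]] by simp
  have eZ: "e \<in> Zp" using e by (auto dest: padic_cong_in_Zp)
  have ee: "padic_cong 2 (e * e) 0"
    using padic_cong_scale_1[OF e e] by simp
  have term_cong: "padic_cong 2 (1 / (e + of_nat k)) (1 / of_nat k - e * (1 / (of_nat k)\<^sup>2))"
    if k: "0 < k" "k < ?p" for k
  proof -
    have "padic_cong 1 (e + of_nat k) (0 + of_nat k)"
      by (intro padic_cong_add e padic_cong_refl) auto
    then have ek: "padic_cong 1 (e + of_nat k) (of_nat k)" by simp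
    have "\<not> ?p dvd k" using k by (auto dest: dvd_imp_le)
    note unit = padic_unit[OF ek this]
    \<comment> \<open>The exact remainder of the expansion is e^2 / (k^2 (e + k)).\<close>
    have "padic_cong 2 (e * e * (1 / (of_nat k)\<^sup>2 * (1 / (e + of_nat k)))
        + (1 / of_nat k - e * (1 / (of_nat k)\<^sup>2)))
      (0 * (1 / (of_nat k)\<^sup>2 * (1 / (e + of_nat k))) + (1 / of_nat k - e * (1 / (of_nat k)\<^sup>2)))"
      using k eZ by (intro padic_cong_add padic_cong_mult[OF ee] padic_cong_refl Zp_mult Zp_diff
        inverse_square_in_Zp inverse_of_nat_in_Zp unit)
    moreover have "e * e * (1 / (of_nat k)\<^sup>2 * (1 / (e + of_nat k)))
        + (1 / of_nat k - e * (1 / (of_nat k)\<^sup>2)) = 1 / (e + of_nat k)"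
      using unit(1) k(1) by (simp add: divide_simps power2_eq_square) (simp add: algebra_simps)
    ultimately show ?thesis by simp
  qed
  have B: "padic_cong 1 (bernpoly (?p - 2) x) (- 2 * (\<Sum>k\<in>{0<..<Suc r}. 1 / (of_nat k)\<^sup>2))"
    using assms by (intro bernpoly_card_minus_2_cong) auto
  \<comment> \<open>Reversing the order by k -> r + 1 - k makes the denominators e + k.\<close>
  have "(\<Sum>k\<in>{0<..<Suc r}. 1 / (x - of_nat k)) = (\<Sum>k\<in>{0<..<Suc r}. 1 / (e + of_nat k))"
  proof (rule sum.reindex_bij_witness[of _ "\<lambda>k. Suc r - k" "\<lambda>k. Suc r - k"])
    fix k assume "k \<in> {0<..<Suc r}"
    then have "(of_nat (Suc r - k) :: 'p padic) = of_nat (Suc r) - of_nat k"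
      by (intro of_nat_diff) simp
    then show "1 / (e + of_nat (Suc r - k)) = 1 / (x - of_nat k)"
      by (simp only: e_def) simp
  qed auto
  then have "2 * (\<Sum>k\<in>{0<..<Suc r}. 1 / (x - of_nat k)) = 2 * (\<Sum>k\<in>{0<..<Suc r}. 1 / (e + of_nat k))"
    by simp
  also have "padic_cong 2 \<dots> (2 * (\<Sum>k\<in>{0<..<Suc r}. 1 / of_nat k - e * (1 / (of_nat k)\<^sup>2)))"
    using assms(2) by (intro padic_cong_mult padic_cong_refl padic_cong_sum term_cong) auto
  also have "2 * (\<Sum>k\<in>{0<..<Suc r}. 1 / of_nat k - e * (1 / (of_nat k)\<^sup>2))
      = 2 * harmonic r + e * (- 2 * (\<Sum>k\<in>{0<..<Suc r}. 1 / (of_nat k)\<^sup>2))"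
  proof -
    have "{0<..<Suc r} = {0<..r}" by auto
    then show ?thesis
      by (simp add: harmonic_def sum_subtractf sum_distrib_left sum_negf algebra_simps)
  qed
  \<comment> \<open>The Bernoulli value is needed only modulo p, since e supplies the other factor
    p.\<close>
  also have "padic_cong 2 \<dots> (2 * harmonic r + e * bernpoly (?p - 2) x)"
    using assms(2) by (intro padic_cong_add padic_cong_refl padic_cong_scale_1 e padic_cong_sym[OF B]
      Zp_mult harmonic_in_Zp) auto
  finally show ?thesis by (simp only: e_def)
qed

text \<open>The exponent in the first congruence is an integer power because it is -1 at residue 0;
  the sum beside it is then empty.\<close>

theorem theorem1p1:
  fixes p :: nat and a :: "'p::prime_card padic_int"
  assumes "p = CARD('p)" and "p > 3"
  shows "let \<alpha> = to_fract a;
             S = (\<Sum>k=0..p-1. ((- \<alpha>) gchoose k) * ((\<alpha> - 1) gchoose k) * harmonic k)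
    in padic_cong 2 S
         ((- 1) powi (int (padic_residue a) - 1) * 2 *
           (\<Sum>k\<in>{0<..<padic_residue a}. 1 / (\<alpha> - of_nat k)))
     \<and> padic_cong 2 S
         ((- 1) ^ padic_residue (a - 1) *
           (2 * harmonic (padic_residue (a - 1)) +
             (\<alpha> - of_nat (padic_residue a)) * bernpoly (p - 2) \<alpha>))
     \<and> padic_cong 1 S
         ((- 1) ^ padic_residue a * 2 *
           (bernpoly (p - 1) \<alpha> - of_rat (bernoulli (p - 1))))"
proof -
  define \<alpha> where "\<alpha> = to_fract a"
  define S where "S = (\<Sum>k\<le>p - 1. twin_binomial k \<alpha> * harmonic k)"
  define r where "r = padic_residue a"
  define \<beta> where "\<beta> = bernpoly (p - 1) \<alpha> - of_rat (bernoulli (p - 1))"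
  define I where "I = (\<Sum>k\<in>{0<..<r}. 1 / (\<alpha> - of_nat k))"
  have r: "padic_cong 1 \<alpha> (of_nat r)" "r < p"
    unfolding \<alpha>_def r_def assms(1) by (rule padic_cong_residue, rule padic_residue_less)
  have \<beta>: "padic_cong 1 \<beta> (- (\<Sum>k\<in>{0<..<r}. 1 / of_nat k))"
    using bernpoly_cong_power_sum[OF r(1), of 1] r(2) assms by (simp add: \<beta>_def)
  have e: "padic_cong 1 (\<alpha> - of_nat r) 0"
    using padic_cong_diff[OF r(1) padic_cong_refl[of "of_nat r"]] by simp
  have a1: "to_fract (a - 1) = \<alpha> - 1" by (simp add: \<alpha>_def)
  have B: "padic_cong 1 (bernpoly (p - 2) \<alpha>) (- 2 * (\<Sum>k\<in>{0<..<r}. 1 / (of_nat k)\<^sup>2))"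
    unfolding assms(1) using r assms by (intro bernpoly_card_minus_2_cong) auto
  have "padic_cong 2 S ((- 1) powi (int r - 1) * 2 * I)
     \<and> padic_cong 2 S ((- 1) ^ padic_residue (a - 1) *
           (2 * harmonic (padic_residue (a - 1)) + (\<alpha> - of_nat r) * bernpoly (p - 2) \<alpha>))
     \<and> padic_cong 1 S ((- 1) ^ r * 2 * \<beta>)"
  proof (cases r)
    case 0
    then have \<alpha>0: "padic_cong 1 \<alpha> 0" using r by simp
    have S: "padic_cong 2 S 0"
      unfolding S_def assms(1) using \<alpha>0 assms by (intro sum_twin_binomial_harmonic_cong_0) auto
    \<comment> \<open>At residue 0 the residue of a - 1 wraps around to p - 1, so the second
      congruence needs Wolstenholme's theorem.\<close>
    have "padic_cong 1 (\<alpha> - 1) (of_nat (p - 1))"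
    proof -
      have "padic_cong 1 (\<alpha> - 1) (of_nat p - 1)"
        unfolding assms(1)
        by (intro padic_cong_diff padic_cong_trans[OF \<alpha>0 padic_cong_sym[OF padic_cong_card]]) auto
      then show ?thesis using assms(2) by (simp add: of_nat_diff)
    qed
    then have res: "padic_residue (a - 1) = p - 1"
      using assms a1 by (intro padic_residue_eqI) auto
    \<comment> \<open>For r = 0 the power sum in \<open>B\<close> is empty; the product with
      \<open>\<alpha>\<close> is then divisible by p^2.\<close>
    have "padic_cong 1 (bernpoly (p - 2) \<alpha>) 0"
      using B 0 by simp
    from padic_cong_scale_1[OF \<alpha>0 this]
    have "padic_cong 2 (2 * harmonic (p - 1) + \<alpha> * bernpoly (p - 2) \<alpha>) (0 + \<alpha> * 0)"
      unfolding assms(1) using assms by (intro padic_cong_add twice_harmonic_card_cong_0) auto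
    then have "padic_cong 2 ((- 1) ^ (p - 1) * (2 * harmonic (p - 1) + \<alpha> * bernpoly (p - 2) \<alpha>))
        ((- 1) ^ (p - 1) * (0 + \<alpha> * 0))"
      by (intro padic_cong_mult padic_cong_refl) auto
    then have "padic_cong 2 0 ((- 1) ^ (p - 1) * (2 * harmonic (p - 1) + \<alpha> * bernpoly (p - 2) \<alpha>))"
      using padic_cong_sym by fastforce
    from padic_cong_trans[OF S this]
    have "padic_cong 2 S ((- 1) ^ (p - 1) * (2 * harmonic (p - 1) + \<alpha> * bernpoly (p - 2) \<alpha>))" .
    moreover have "padic_cong 1 ((- 1) ^ r * 2 * \<beta>) 0"
      using \<beta> 0 padic_cong_mult[OF padic_cong_refl[of 2] \<beta>] by simp
    then have "padic_cong 1 S ((- 1) ^ r * 2 * \<beta>)"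
      using padic_cong_mono[OF S, of 1] padic_cong_sym padic_cong_trans by fastforce
    ultimately show ?thesis
      using S 0 by (simp add: I_def res)
  next
    case (Suc s)
    have "padic_cong 1 (\<alpha> - 1) (of_nat s)"
      using padic_cong_diff_1[of 1 \<alpha> s] r Suc by simp
    then have res: "padic_residue (a - 1) = s"
      using r(2) Suc assms a1 by (intro padic_residue_eqI) auto
    have c1: "padic_cong 2 S ((- 1) ^ s * 2 * I)"
      unfolding S_def I_def assms(1) Suc using r Suc assms by (intro sum_twin_binomial_harmonic_cong) auto
    have "padic_cong 2 (2 * I) (2 * harmonic s + (\<alpha> - of_nat r) * bernpoly (p - 2) \<alpha>)"
      unfolding I_def assms(1) Suc using r Suc assms by (intro sum_inverse_cong) auto
    from padic_cong_mult[OF padic_cong_refl[of "(- 1) ^ s"] this]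
    have c2: "padic_cong 2 S ((- 1) ^ s * (2 * harmonic s + (\<alpha> - of_nat r) * bernpoly (p - 2) \<alpha>))"
      using padic_cong_trans[OF c1] by (simp add: mult.assoc)
    have "bernpoly (p - 2) \<alpha> \<in> Zp"
      using B by (rule padic_cong_in_Zp)
    \<comment> \<open>The third congruence is the second reduced modulo p: the term with factor
      \<open>\<alpha> - of_nat r\<close> disappears, and the remaining harmonic number is
      -\<open>\<beta>\<close> modulo p.\<close>
    then have "padic_cong 1 ((- 1) ^ s * (2 * harmonic s + (\<alpha> - of_nat r) * bernpoly (p - 2) \<alpha>))
        ((- 1) ^ s * (2 * harmonic s + 0 * bernpoly (p - 2) \<alpha>))"
      using r(2) Suc assms
      by (intro padic_cong_mult padic_cong_add padic_cong_refl e Zp_mult harmonic_in_Zp) auto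
    with padic_cong_mono[OF c2, of 1] have "padic_cong 1 S ((- 1) ^ s * 2 * harmonic s)"
      using padic_cong_trans by (fastforce simp: mult.assoc)
    also have "(- 1) ^ s * 2 * harmonic s = (- 1) ^ r * 2 * (- (\<Sum>k\<in>{0<..<r}. 1 / of_nat k))"
    proof -
      have "{0<..<r} = {0<..s}" using Suc by auto
      then show ?thesis by (simp add: Suc harmonic_def)
    qed
    also have "padic_cong 1 \<dots> ((- 1) ^ r * 2 * \<beta>)"
      by (intro padic_cong_mult padic_cong_refl padic_cong_sym[OF \<beta>]) auto
    finally show ?thesis
      using c1 c2 by (simp add: Suc res)
  qed
  then show ?thesis
    by (simp add: Let_def S_def I_def \<alpha>_def r_def \<beta>_def twin_binomial_def atLeast0AtMost)
qed

end
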